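(* Let $\Phi=(G,\varphi)$ be a $\mathbb{T}$-gain graph on a connected triangle-free simple graph $G$ with minimum vertex degree $\delta$. Then $\mathcal{E}(\Phi)\geq 2\delta$. Equality holds if and only if $\Phi$ is balanced and $G$ is the complete bipartite graph with both partite sets of size $\delta$ (i.e. $G=K_{\delta,\delta}$).
   Context: Let $\mathbb{T}=\{z\in\mathbb{C}:|z|=1\}$. A $\mathbb{T}$-gain graph $\Phi=(G,\varphi)$ is a simple graph $G$ with a map $\varphi$ assigning to each oriented edge $\vec e_{p,q}$ a value in $\mathbb{T}$ with $\varphi(\vec{e}_{p,q})=\varphi(\vec{e}_{q,p})^{-1}$. Its adjacency matrix $A(\Phi)$ is the Hermitian matrix with $(p,q)$ entry $\varphi(\vec{e}_{p,q})$ if $v_p\sim v_q$ and $0$ otherwise. The energy $\mathcal{E}(\Phi)$ is the sum of the absolute values of the eigenvalues of $A(\Phi)$. The gain of a cycle $v_1\sim\cdots\sim v_k\sim v_1$ is $\varphi(\vec e_{1,2})\cdots\varphi(\vec e_{k,1})$; $\Phi$ is balanced if every cycle has gain $1$. A graph is triangle-free if it contains no triangle.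
   Formalization: The equality characterization is stated only for minimum degree δ ≥ 1, since for the one-vertex graph (δ = 0) the energy is 0 = 2δ although it is not the complete bipartite graph with both parts empty; the inequality is stated without this restriction. *)

theory Defs
  imports
    "Graph_Theory.Graph_Theory"
    "Jordan_Normal_Form.Char_Poly"
begin

text \<open>
  A finite simple graph is a \<^locale>\<open>pair_graph\<close>: a finite, symmetric, loop-free digraph without
  parallel arcs. Its arcs are the oriented edges, each edge being present in both orientations.
\<close>

locale gain_graph = pair_graph G for G :: "'a pair_pre_digraph" +
  fixes \<phi> :: "'a \<times> 'a \<Rightarrow> complex"
  assumes gain_unit: "(u, v) \<in> parcs G \<Longrightarrow> cmod (\<phi> (u, v)) = 1"
    and gain_inverse: "(u, v) \<in> parcs G \<Longrightarrow> \<phi> (u, v) = inverse (\<phi> (v, u))"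

text \<open>The list \<open>vs\<close> enumerates the vertices as $v_1, \dots, v_n$, fixing the order of rows and columns.\<close>

definition gain_adjacency_matrix ::
    "'a pair_pre_digraph \<Rightarrow> ('a \<times> 'a \<Rightarrow> complex) \<Rightarrow> 'a list \<Rightarrow> complex mat" where
  "gain_adjacency_matrix G \<phi> vs =
     mat (length vs) (length vs)
       (\<lambda>(i, j). if (vs ! i, vs ! j) \<in> parcs G then \<phi> (vs ! i, vs ! j) else 0)"

text \<open>Eigenvalues are counted with their multiplicity as roots of the characteristic polynomial.\<close>

definition matrix_energy :: "complex mat \<Rightarrow> real" where
  "matrix_energy A = (\<Sum>k | eigenvalue A k. real (order k (char_poly A)) * cmod k)"

definition gain_energy ::
    "'a pair_pre_digraph \<Rightarrow> ('a \<times> 'a \<Rightarrow> complex) \<Rightarrow> 'a list \<Rightarrow> real" where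
  "gain_energy G \<phi> vs = matrix_energy (gain_adjacency_matrix G \<phi> vs)"

text \<open>
  The length bound excludes the closed walks $u, v, u$, which \<^const>\<open>pre_digraph.cycle\<close> admits in a
  symmetric digraph but which are not cycles of the simple graph.
\<close>

definition gain_balanced :: "'a pair_pre_digraph \<Rightarrow> ('a \<times> 'a \<Rightarrow> complex) \<Rightarrow> bool" where
  "gain_balanced G \<phi> \<longleftrightarrow>
     (\<forall>p. pre_digraph.cycle (with_proj G) p \<and> 3 \<le> length p \<longrightarrow> prod_list (map \<phi> p) = 1)"

definition triangle_free :: "'a pair_pre_digraph \<Rightarrow> bool" where
  "triangle_free G \<longleftrightarrow>
     \<not> (\<exists>u v w. (u, v) \<in> parcs G \<and> (v, w) \<in> parcs G \<and> (w, u) \<in> parcs G)"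

text \<open>In a symmetric digraph the out-degree of a vertex is its degree in the simple graph.\<close>

definition min_degree :: "'a pair_pre_digraph \<Rightarrow> nat" where
  "min_degree G = Min (out_degree (with_proj G) ` pverts G)"

end

theory Submission
  imports Defs "Jordan_Normal_Form.Schur_Decomposition"
begin

text \<open>
  Let $A$ be the gain adjacency matrix, with real eigenvalues $\lambda_i$, and let $M$ be the number
  of arcs, so that $\sum \lambda_i^2 = \mathrm{tr}\, A^2 = M$. Without triangles there are no closed
  walks of length $3$, so $\sum \lambda_i^3 = 0$. Moving the eigenvalue of largest modulus $\rho$
  to the other side gives $\rho^3 \le \rho (M - \rho^2)$, that is $\rho^2 \le M/2$ (Nosal's argument).
  Hence $M \le \rho \sum |\lambda_i|$ yields $\mathcal{E}^2 \ge 2M$. Adjacent vertices have disjoint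
  neighbourhoods, so there are at least $2\delta$ vertices, whence $M \ge 2\delta^2$ and
  $\mathcal{E} \ge 2\delta$.

  Equality forces $M = 2\delta^2$, which makes the graph $K_{\delta,\delta}$, and
  $\lambda_i^3 = \delta^2 \lambda_i$ for all $i$. For Hermitian $A$ the latter is equivalent to
  $A^3 = \delta^2 A$, because the sum of the $(\lambda_i^3 - \delta^2 \lambda_i)^2$ is the squared
  Frobenius norm of $A^3 - \delta^2 A$. On $K_{\delta,\delta}$ this says that the gains of the
  $\delta^2$ walks of length $3$ from $p$ to an adjacent $q$, all of modulus $1$, have mean
  $\varphi(p,q)$; so each of them equals $\varphi(p,q)$, which is balancedness.
\<close>

section \<open>Traces and spectra\<close>

definition mat_trace :: "'a :: comm_monoid_add mat \<Rightarrow> 'a" where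
  "mat_trace A = (\<Sum>i<dim_row A. A $$ (i, i))"

lemma mult_mat_index:
  assumes "A \<in> carrier_mat n m" "B \<in> carrier_mat m p" "i < n" "j < p"
  shows "(A * B) $$ (i, j) = (\<Sum>k<m. A $$ (i, k) * B $$ (k, j))"
  using assms by (auto simp: scalar_prod_def lessThan_atLeast0 intro!: sum.cong)

lemma mat_trace_mult:
  assumes "A \<in> carrier_mat n m" "B \<in> carrier_mat m n"
  shows "mat_trace (A * B) = (\<Sum>i<n. \<Sum>j<m. A $$ (i, j) * B $$ (j, i))"
proof -
  have "(A * B) $$ (i, i) = (\<Sum>j<m. A $$ (i, j) * B $$ (j, i))" if "i < n" for i
    using mult_mat_index[OF assms that that] .
  then show ?thesis
    unfolding mat_trace_def using assms(1) by simp
qed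

lemma mat_trace_mult_commute:
  fixes A B :: "'a :: comm_semiring_0 mat"
  assumes "A \<in> carrier_mat n m" "B \<in> carrier_mat m n"
  shows "mat_trace (A * B) = mat_trace (B * A)"
  unfolding mat_trace_mult[OF assms] mat_trace_mult[OF assms(2,1)]
  by (subst sum.swap) (intro sum.cong refl mult.commute)

lemma mat_trace_similar:
  fixes A B :: "'a :: comm_semiring_1 mat"
  assumes "A \<in> carrier_mat n n" "similar_mat_wit A B P Q"
  shows "mat_trace A = mat_trace B"
proof -
  note w = similar_mat_witD2[OF assms]
  have "mat_trace A = mat_trace (Q * (P * B))"
    unfolding w(3) using w by (intro mat_trace_mult_commute[of _ n n]) auto
  also have "Q * (P * B) = (Q * P) * B"
    using w by (intro assoc_mult_mat[symmetric]) auto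
  also have "\<dots> = B"
    using w by simp
  finally show ?thesis .
qed

section \<open>Powers of upper triangular matrices and their traces\<close>

lemma upper_triangular_mult_index:
  fixes A B :: "'a :: semiring_1 mat"
  assumes A: "A \<in> carrier_mat n n" "upper_triangular A"
    and B: "B \<in> carrier_mat n n" "upper_triangular B"
    and ij: "i < n" "j \<le> i"
  shows "(A * B) $$ (i, j) = (if j = i then A $$ (i, i) * B $$ (i, i) else 0)"
proof -
  have "(A * B) $$ (i, j) = (\<Sum>k<n. A $$ (i, k) * B $$ (k, j))"
    using A B ij by (intro mult_mat_index) auto
  also have "\<dots> = (\<Sum>k<n. if k = i then if j = i then A $$ (i, i) * B $$ (i, i) else 0 else 0)"
  proof (intro sum.cong refl)
    fix k assume "k \<in> {..<n}"
    then have "k < n" by simp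
    \<comment> \<open>For \<open>k < i\<close> the entry of \<open>A\<close> lies below the
      diagonal; for \<open>k > i\<close> the entry of \<open>B\<close> does, because
      \<open>j \<le> i < k\<close>. Only \<open>k = i\<close> is left, and there
      \<open>B $$ (i, j)\<close> vanishes unless \<open>j = i\<close>.\<close>
    consider "k < i" | "k = i" | "k > i" by linarith
    then show "A $$ (i, k) * B $$ (k, j) =
        (if k = i then if j = i then A $$ (i, i) * B $$ (i, i) else 0 else 0)"
    proof cases
      case 1
      then show ?thesis using upper_triangularD[OF A(2), of k i] A(1) ij by auto
    next
      case 2
      then show ?thesis using upper_triangularD[OF B(2), of j i] B(1) ij by auto
    next
      case 3
      then show ?thesis using upper_triangularD[OF B(2), of j k] B(1) ij \<open>k < n\<close> by auto
    qed
  qed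
  also have "\<dots> = (if j = i then A $$ (i, i) * B $$ (i, i) else 0)"
    using ij by simp
  finally show ?thesis .
qed

lemma upper_triangular_pow:
  fixes A :: "'a :: semiring_1 mat"
  assumes A: "A \<in> carrier_mat n n" "upper_triangular A"
  shows "upper_triangular (A ^\<^sub>m k) \<and> (\<forall>i<n. (A ^\<^sub>m k) $$ (i, i) = A $$ (i, i) ^ k)"
proof (induction k)
  case 0
  then show ?case using A by auto
next
  case (Suc k)
  have P: "A ^\<^sub>m k \<in> carrier_mat n n" using A by simp
  note index = upper_triangular_mult_index[OF P _ A]
  have "upper_triangular (A ^\<^sub>m k * A)"
    using Suc A by (intro upper_triangularI) (simp add: index del: index_mult_mat(1))
  moreover have "(A ^\<^sub>m k * A) $$ (i, i) = A $$ (i, i) ^ Suc k" if "i < n" for i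
    using Suc that by (simp only: index le_refl power_Suc2) simp
  ultimately show ?case by simp
qed

text \<open>By Schur decomposition \<open>A\<close> is similar to an upper triangular
  \<open>B\<close> with diagonal \<open>es\<close>. Similarity passes to powers and preserves
  traces, and the diagonal of \<open>B ^\<^sub>m k\<close> consists of \<open>k\<close>-th
  powers.\<close>

lemma mat_trace_pow:
  fixes A :: "'a :: conjugatable_ordered_field mat"
  assumes A: "A \<in> carrier_mat n n" and c: "char_poly A = (\<Prod>e\<leftarrow>es. [:- e, 1:])"
  shows "mat_trace (A ^\<^sub>m k) = (\<Sum>e\<leftarrow>es. e ^ k)"
proof -
  obtain B P Q where s: "schur_decomposition A es = (B, P, Q)"
    by (cases "schur_decomposition A es")
  note d = schur_decomposition[OF A c s]
  then have B: "B \<in> carrier_mat n n" using similar_mat_witD2(5)[OF A] by blast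
  have ut: "upper_triangular B" using d by simp
  have "mat_trace (A ^\<^sub>m k) = mat_trace (B ^\<^sub>m k)"
    using A d by (intro mat_trace_similar similar_mat_wit_pow) auto
  also have "\<dots> = (\<Sum>i<n. B $$ (i, i) ^ k)"
    using B upper_triangular_pow[OF B ut, of k] by (auto simp: mat_trace_def)
  also have "\<dots> = (\<Sum>e\<leftarrow>diag_mat B. e ^ k)"
    using B by (simp add: diag_mat_def interv_sum_list_conv_sum_set_nat o_def lessThan_atLeast0)
  also have "\<dots> = (\<Sum>e\<leftarrow>es. e ^ k)" using d by simp
  finally show ?thesis .
qed

section \<open>Root multiplicities and the energy as a sum over a list\<close>

lemma order_prod_list_linear:
  "Polynomial.order x (\<Prod>e\<leftarrow>es. [:- e, 1:]) = count_list es (x :: 'a :: idom)"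
proof (induction es)
  case (Cons e es)
  have "(\<Prod>e\<leftarrow>es. [:- e, 1:]) \<noteq> 0" by (auto simp: prod_list_zero_iff)
  then have "[:- e, 1:] * (\<Prod>e\<leftarrow>es. [:- e, 1:]) \<noteq> 0" by (metis mult_eq_0_iff pCons_eq_0_iff zero_neq_one)
  moreover have "Polynomial.order x [:- e, 1:] = (if x = e then 1 else 0)"
  proof (cases "x = e")
    case True
    then show ?thesis using order_power_n_n[of e 1] by simp
  next
    case False
    then show ?thesis by (simp add: order_0I)
  qed
  ultimately show ?case
    using Cons.IH order_mult[of "[:- e, 1:]" "\<Prod>e\<leftarrow>es. [:- e, 1:]" x]
    by (simp del: mult_pCons_left)
qed simp

lemma eigenvalue_iff_char_poly_roots:
  fixes A :: "'a :: field mat"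
  assumes "A \<in> carrier_mat n n" "char_poly A = (\<Prod>e\<leftarrow>es. [:- e, 1:])"
  shows "eigenvalue A k \<longleftrightarrow> k \<in> set es"
  by (simp add: eigenvalue_root_char_poly[OF assms(1)] assms(2) poly_prod_list prod_list_zero_iff image_iff)

lemma sum_list_map_eq_sum_of_nat_count:
  fixes f :: "'a \<Rightarrow> 'b :: semiring_1"
  shows "(\<Sum>x\<leftarrow>xs. f x) = (\<Sum>x\<in>set xs. of_nat (count_list xs x) * f x)"
proof -
  \<comment> \<open>The index set is generalised to a fixed finite superset \<open>X\<close>, since
    \<open>set xs\<close> changes during the induction; elements of \<open>X\<close> outside the
    list have count 0.\<close>
  have "(\<Sum>x\<leftarrow>xs. f x) = (\<Sum>x\<in>X. of_nat (count_list xs x) * f x)"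
    if "finite X" "set xs \<subseteq> X" for X
    using that(2)
  proof (induction xs)
    case (Cons y ys)
    have "(\<Sum>x\<in>X. of_nat (count_list (y # ys) x) * f x) =
        (\<Sum>x\<in>X. (if y = x then f x else 0) + of_nat (count_list ys x) * f x)"
      by (intro sum.cong refl) (simp add: algebra_simps)
    also have "\<dots> = f y + (\<Sum>x\<in>X. of_nat (count_list ys x) * f x)"
      using Cons.prems that(1) by (simp add: sum.distrib)
    finally show ?case using Cons by simp
  qed simp
  then show ?thesis by simp
qed

text \<open>The order of a root is its number of occurrences in \<open>es\<close>, so weighting
  distinct eigenvalues by multiplicity amounts to running through the list.\<close>

lemma matrix_energy_eq:
  assumes A: "A \<in> carrier_mat n n" and c: "char_poly A = (\<Prod>e\<leftarrow>es. [:- e, 1:])"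
  shows "matrix_energy A = (\<Sum>e\<leftarrow>es. cmod e)"
proof -
  have "matrix_energy A = (\<Sum>k\<in>set es. real (count_list es k) * cmod k)"
    unfolding matrix_energy_def eigenvalue_iff_char_poly_roots[OF A c]
    by (simp add: c order_prod_list_linear)
  also have "\<dots> = (\<Sum>e\<leftarrow>es. cmod e)"
    by (rule sum_list_map_eq_sum_of_nat_count[symmetric])
  finally show ?thesis .
qed

section \<open>Hermitian matrices\<close>

definition hermitian_mat :: "complex mat \<Rightarrow> bool" where
  "hermitian_mat A \<longleftrightarrow> square_mat A \<and>
     (\<forall>i<dim_row A. \<forall>j<dim_row A. A $$ (j, i) = cnj (A $$ (i, j)))"

lemma hermitian_mat_index:
  assumes "hermitian_mat A" "A \<in> carrier_mat n n" "i < n" "j < n"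
  shows "cnj (A $$ (i, j)) = A $$ (j, i)"
  using assms unfolding hermitian_mat_def by (metis carrier_matD(1))

lemma pow_mat_add:
  fixes A :: "'a :: semiring_1 mat"
  assumes "A \<in> carrier_mat n n"
  shows "A ^\<^sub>m (k + l) = A ^\<^sub>m k * A ^\<^sub>m l"
proof (induction l)
  case 0
  then show ?case using assms by simp
next
  case (Suc l)
  have "A ^\<^sub>m (k + Suc l) = (A ^\<^sub>m k * A ^\<^sub>m l) * A" using Suc by simp
  also have "\<dots> = A ^\<^sub>m k * (A ^\<^sub>m l * A)"
    using assms by (intro assoc_mult_mat) auto
  finally show ?case by simp
qed

lemma hermitian_mat_pow:
  assumes h: "hermitian_mat A" and A: "A \<in> carrier_mat n n"
  shows "hermitian_mat (A ^\<^sub>m k)"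
proof (induction k)
  case 0
  then show ?case using A by (auto simp: hermitian_mat_def)
next
  case (Suc k)
  have P: "A ^\<^sub>m k \<in> carrier_mat n n" using A by simp
  show ?case
    unfolding hermitian_mat_def
  proof (intro conjI allI impI)
    show "square_mat (A ^\<^sub>m Suc k)" using A by simp
    fix i j assume "i < dim_row (A ^\<^sub>m Suc k)" "j < dim_row (A ^\<^sub>m Suc k)"
    then have ij: "i < n" "j < n" using A P by auto
    \<comment> \<open>Conjugate transposition reverses products, so the new factor \<open>A\<close>
      is split off on the left here and on the right at the end.\<close>
    have "(A ^\<^sub>m Suc k) $$ (j, i) = (\<Sum>l<n. A $$ (j, l) * (A ^\<^sub>m k) $$ (l, i))"
      using pow_mat_add[OF A, of 1 k] mult_mat_index[OF A P ij(2,1)] A by simp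
    also have "\<dots> = cnj (\<Sum>l<n. (A ^\<^sub>m k) $$ (i, l) * A $$ (l, j))"
      unfolding cnj_sum using ij
      by (intro sum.cong refl)
        (simp add: hermitian_mat_index[OF h A] hermitian_mat_index[OF Suc P] mult.commute)
    also have "\<dots> = cnj ((A ^\<^sub>m Suc k) $$ (i, j))"
      using mult_mat_index[OF P A ij] by simp
    finally show "(A ^\<^sub>m Suc k) $$ (j, i) = cnj ((A ^\<^sub>m Suc k) $$ (i, j))" .
  qed
qed

lemma hermitian_mat_eigenvalue_Reals:
  assumes h: "hermitian_mat A" and A: "A \<in> carrier_mat n n" and e: "eigenvalue A k"
  shows "k \<in> \<real>"
proof -
  obtain v where v: "v \<in> carrier_vec n" "v \<noteq> 0\<^sub>v n" "A *\<^sub>v v = k \<cdot>\<^sub>v v"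
    using e A by (auto simp: eigenvalue_def eigenvector_def)
  \<comment> \<open>Rayleigh quotient: \<open>q\<close> is the Hermitian form of \<open>A\<close> at
    \<open>v\<close> and \<open>s\<close> the squared norm of \<open>v\<close>. The eigenvector
    equation gives \<open>q = k * s\<close>; conjugating and swapping indices shows that
    \<open>q\<close> is real.\<close>
  define q where "q = (\<Sum>i<n. \<Sum>j<n. cnj (v $ i) * A $$ (i, j) * v $ j)"
  define s where "s = (\<Sum>i<n. (cmod (v $ i))\<^sup>2)"
  have "(\<Sum>j<n. A $$ (i, j) * v $ j) = k * v $ i" if "i < n" for i
    using arg_cong[OF v(3), of "\<lambda>x. x $ i"] that A v(1)
    by (simp add: scalar_prod_def lessThan_atLeast0)
  then have "q = (\<Sum>i<n. cnj (v $ i) * (k * v $ i))"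
    unfolding q_def by (simp add: mult.assoc flip: sum_distrib_left)
  also have "\<dots> = k * of_real s"
    unfolding s_def of_real_sum sum_distrib_left
    by (intro sum.cong refl) (simp add: complex_norm_square[symmetric] mult_ac del: of_real_power)
  finally have qs: "q = k * of_real s" .
  have "cnj q = (\<Sum>i<n. \<Sum>j<n. v $ i * A $$ (j, i) * cnj (v $ j))"
    unfolding q_def cnj_sum by (intro sum.cong refl) (simp add: hermitian_mat_index[OF h A])
  also have "\<dots> = q"
    unfolding q_def by (subst sum.swap) (simp add: mult_ac)
  finally have "cnj k * of_real s = k * of_real s" using qs by simp
  moreover have "s \<noteq> 0"
  proof
    assume "s = 0"
    then have "\<forall>i<n. v $ i = 0" unfolding s_def by (subst (asm) sum_nonneg_eq_0_iff) auto
    then show False using v by (auto intro: eq_vecI)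
  qed
  ultimately show ?thesis by (simp add: Reals_cnj_iff)
qed

section \<open>Real lists with vanishing sum of cubes\<close>

lemma sum_list_eq_0_iff_nonneg:
  fixes f :: "'a \<Rightarrow> real"
  assumes "\<And>x. x \<in> set xs \<Longrightarrow> 0 \<le> f x"
  shows "(\<Sum>x\<leftarrow>xs. f x) = 0 \<longleftrightarrow> (\<forall>x\<in>set xs. f x = 0)"
  using sum_list_nonneg_eq_0_iff[of "map f xs"] assms by auto

text \<open>It suffices to bound the largest modulus \<open>r\<close>. The cube of an entry
  attaining it is balanced by the other cubes, each of modulus at most \<open>r\<close> times the
  corresponding square.\<close>

lemma sum_list_cubes_bound:
  fixes es :: "real list"
  assumes cubes: "(\<Sum>x\<leftarrow>es. x ^ 3) = 0" and e: "e \<in> set es"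
  shows "2 * e\<^sup>2 \<le> (\<Sum>x\<leftarrow>es. x\<^sup>2)"
proof -
  define r where "r = Max ((\<lambda>x. \<bar>x\<bar>) ` set es)"
  have le: "\<bar>x\<bar> \<le> r" if "x \<in> set es" for x
    using that by (auto simp: r_def)
  have "r \<in> (\<lambda>x. \<bar>x\<bar>) ` set es"
    unfolding r_def using e by (intro Max_in) auto
  then obtain m where m: "m \<in> set es" "\<bar>m\<bar> = r" by auto
  \<comment> \<open>A single occurrence of \<open>m\<close> is removed; repetitions of
    \<open>m\<close> stay in \<open>xs @ ys\<close>.\<close>
  obtain xs ys where es: "es = xs @ m # ys" using split_list[OF m(1)] by blast
  have "m ^ 3 = - (\<Sum>x\<leftarrow>xs @ ys. x ^ 3)" using cubes by (simp add: es)
  then have "r ^ 3 = \<bar>\<Sum>x\<leftarrow>xs @ ys. x ^ 3\<bar>" using m(2) by (metis abs_minus power_abs)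
  also have "\<dots> \<le> (\<Sum>x\<leftarrow>xs @ ys. \<bar>x ^ 3\<bar>)"
    using sum_list_abs[of "map (\<lambda>x. x ^ 3) (xs @ ys)"] by (simp add: o_def)
  also have "\<dots> \<le> (\<Sum>x\<leftarrow>xs @ ys. r * x\<^sup>2)"
  proof (rule sum_list_mono)
    fix x assume "x \<in> set (xs @ ys)"
    then have "\<bar>x\<bar> * x\<^sup>2 \<le> r * x\<^sup>2" using le[of x] es by (intro mult_right_mono) auto
    then show "\<bar>x ^ 3\<bar> \<le> r * x\<^sup>2" by (simp add: power3_eq_cube power2_eq_square abs_mult)
  qed
  also have "\<dots> = r * ((\<Sum>x\<leftarrow>es. x\<^sup>2) - r\<^sup>2)"
    using m(2) by (auto simp: es sum_list_const_mult algebra_simps)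
  finally have *: "r ^ 3 \<le> r * ((\<Sum>x\<leftarrow>es. x\<^sup>2) - r\<^sup>2)" .
  have "e\<^sup>2 \<le> r\<^sup>2" using le[OF e] by (simp add: abs_le_square_iff[symmetric])
  show ?thesis
  proof (cases "r = 0")
    case True
    then show ?thesis using \<open>e\<^sup>2 \<le> r\<^sup>2\<close> by (auto intro!: sum_list_nonneg)
  next
    case False
    then have "r > 0" using m(2) by auto
    have "r * (2 * r\<^sup>2) \<le> r * (\<Sum>x\<leftarrow>es. x\<^sup>2)"
      using * by (simp add: power3_eq_cube power2_eq_square algebra_simps)
    then have "2 * r\<^sup>2 \<le> (\<Sum>x\<leftarrow>es. x\<^sup>2)" using \<open>r > 0\<close> by simp
    then show ?thesis using \<open>e\<^sup>2 \<le> r\<^sup>2\<close> by linarith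
  qed
qed

text \<open>Let \<open>r\<close> be the bound on the moduli from the cubes. All terms
  \<open>\<bar>x\<bar> * (r - \<bar>x\<bar>)\<close> are nonnegative and add up to
  \<open>r * T - S\<close> with \<open>S = 2 * r\<^sup>2\<close>, whence
  \<open>2 * r \<le> T\<close>. Equality makes every term vanish, so each entry is 0 or of modulus
  \<open>r\<close>.\<close>

lemma
  fixes es :: "real list"
  assumes cubes: "(\<Sum>x\<leftarrow>es. x ^ 3) = 0"
  shows sum_list_squares_le_abs: "2 * (\<Sum>x\<leftarrow>es. x\<^sup>2) \<le> (\<Sum>x\<leftarrow>es. \<bar>x\<bar>)\<^sup>2"
    and sum_list_squares_eq_absD:
      "2 * (\<Sum>x\<leftarrow>es. x\<^sup>2) = (\<Sum>x\<leftarrow>es. \<bar>x\<bar>)\<^sup>2 \<Longrightarrow> e \<in> set es \<Longrightarrow>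
        e ^ 3 = (\<Sum>x\<leftarrow>es. x\<^sup>2) / 2 * e"
proof -
  define S where "S = (\<Sum>x\<leftarrow>es. x\<^sup>2)"
  define T where "T = (\<Sum>x\<leftarrow>es. \<bar>x\<bar>)"
  define r where "r = sqrt (S / 2)"
  have S: "0 \<le> S" and T: "0 \<le> T" unfolding S_def T_def by (auto intro!: sum_list_nonneg)
  have r: "0 \<le> r" "2 * r\<^sup>2 = S" using S by (auto simp: r_def)
  have le: "\<bar>x\<bar> \<le> r" if "x \<in> set es" for x
  proof (rule power2_le_imp_le)
    show "\<bar>x\<bar>\<^sup>2 \<le> r\<^sup>2"
      using sum_list_cubes_bound[OF cubes that, folded S_def] r(2) unfolding power2_abs by linarith
  qed (rule r(1))
  have nonneg: "0 \<le> \<bar>x\<bar> * (r - \<bar>x\<bar>)" if "x \<in> set es" for x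
    using le[OF that] by simp
  have eq: "(\<Sum>x\<leftarrow>es. \<bar>x\<bar> * (r - \<bar>x\<bar>)) = r * T - S"
    unfolding S_def T_def
    by (simp add: algebra_simps sum_list_subtractf sum_list_const_mult power2_eq_square)
  have "0 \<le> (\<Sum>x\<leftarrow>es. \<bar>x\<bar> * (r - \<bar>x\<bar>))" using nonneg by (auto intro!: sum_list_nonneg)
  then have "r * (2 * r) \<le> r * T" using eq r by (simp add: power2_eq_square)
  then have "2 * r \<le> T" using r T by (cases "r = 0") auto
  then have "(2 * r)\<^sup>2 \<le> T\<^sup>2" using r by (intro power_mono) auto
  then show "2 * S \<le> T\<^sup>2" using r by (simp add: power_mult_distrib)
  assume "2 * S = T\<^sup>2" "e \<in> set es"
  then have "(2 * r)\<^sup>2 = T\<^sup>2" using r by (simp add: power_mult_distrib)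
  then have "2 * r = T" using r T by (metis power2_eq_imp_eq mult_nonneg_nonneg zero_le_numeral)
  then have "r * T - S = 0" using r by (simp add: power2_eq_square flip: \<open>2 * r = T\<close>)
  then have "\<bar>e\<bar> * (r - \<bar>e\<bar>) = 0"
    using sum_list_eq_0_iff_nonneg[of es "\<lambda>x. \<bar>x\<bar> * (r - \<bar>x\<bar>)"] nonneg eq \<open>e \<in> set es\<close> by auto
  then have "e = 0 \<or> e\<^sup>2 = S / 2" using r
    by (metis abs_eq_0 mult_eq_0_iff power2_abs eq_iff_diff_eq_0 nonzero_mult_div_cancel_left
        zero_neq_numeral)
  then show "e ^ 3 = S / 2 * e" by (auto simp: power3_eq_cube power2_eq_square)
qed

section \<open>Energy of a Hermitian matrix from the traces of its powers\<close>

lemma hermitian_mat_real_spectrum: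
  assumes h: "hermitian_mat A" and A: "A \<in> carrier_mat n n"
  obtains rs :: "real list" where
    "matrix_energy A = (\<Sum>r\<leftarrow>rs. \<bar>r\<bar>)"
    "\<And>k. mat_trace (A ^\<^sub>m k) = of_real (\<Sum>r\<leftarrow>rs. r ^ k)"
proof -
  obtain es where c: "char_poly A = (\<Prod>e\<leftarrow>es. [:- e, 1:])"
    using char_poly_factorized[OF A] by blast
  have real: "e \<in> \<real>" if "e \<in> set es" for e
    using hermitian_mat_eigenvalue_Reals[OF h A] eigenvalue_iff_char_poly_roots[OF A c] that by blast
  \<comment> \<open>Since \<open>rs\<close> keeps multiplicities, this one real list serves the
    energy and the traces of all powers.\<close>
  define rs where "rs = map Re es"
  have es: "es = map of_real rs"
    using real by (auto simp: rs_def o_def intro!: map_idI[symmetric])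
  show thesis
  proof
    show "matrix_energy A = (\<Sum>r\<leftarrow>rs. \<bar>r\<bar>)"
      by (simp add: matrix_energy_eq[OF A c] es o_def)
    show "mat_trace (A ^\<^sub>m k) = of_real (\<Sum>r\<leftarrow>rs. r ^ k)" for k
      unfolding mat_trace_pow[OF A c] es by (induction rs) simp_all
  qed
qed

text \<open>Translates a condition on eigenvalues into one on matrix entries, which can be read as a
  statement on walks.\<close>

lemma hermitian_mat_cubic:
  assumes h: "hermitian_mat A" and A: "A \<in> carrier_mat n n"
    and tr: "\<And>k. mat_trace (A ^\<^sub>m k) = of_real (\<Sum>r\<leftarrow>rs. r ^ k)"
  shows "(\<forall>r\<in>set rs. r ^ 3 = c * r) \<longleftrightarrow>
    (\<forall>i<n. \<forall>j<n. (A ^\<^sub>m 3) $$ (i, j) = of_real c * A $$ (i, j))"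
proof -
  define D where "D i j = (A ^\<^sub>m 3) $$ (i, j) - of_real c * A $$ (i, j)" for i j
  have A3: "A ^\<^sub>m 3 \<in> carrier_mat n n" using A by simp
  have 2: "A * A = A ^\<^sub>m 2" using A by (simp add: numeral_2_eq_2)
  have 4: "A ^\<^sub>m 3 * A = A ^\<^sub>m 4" and 6: "A ^\<^sub>m 3 * A ^\<^sub>m 3 = A ^\<^sub>m 6"
    using pow_mat_add[OF A, of 3 1] pow_mat_add[OF A, of 3 3] A by auto
  \<comment> \<open>\<open>D\<close> is Hermitian, so its squared Frobenius norm is the trace of its
    square. Expanding that square leaves only traces of powers of \<open>A\<close>, which
    \<open>tr\<close> turns into sums over \<open>rs\<close>.\<close>
  have "complex_of_real (\<Sum>i<n. \<Sum>j<n. (cmod (D i j))\<^sup>2) = (\<Sum>i<n. \<Sum>j<n. D i j * D j i)"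
    unfolding of_real_sum
  proof (intro sum.cong refl)
    fix i j assume "i \<in> {..<n}" "j \<in> {..<n}"
    then have "cnj (D i j) = D j i"
      by (simp add: D_def hermitian_mat_index[OF h A]
          hermitian_mat_index[OF hermitian_mat_pow[OF h A] A3])
    then show "complex_of_real ((cmod (D i j))\<^sup>2) = D i j * D j i"
      by (metis complex_norm_square)
  qed
  also have "\<dots> = mat_trace (A ^\<^sub>m 3 * A ^\<^sub>m 3) - of_real c * mat_trace (A ^\<^sub>m 3 * A)
      - of_real c * mat_trace (A * A ^\<^sub>m 3) + of_real (c\<^sup>2) * mat_trace (A * A)"
    unfolding mat_trace_mult[OF A3 A3] mat_trace_mult[OF A3 A] mat_trace_mult[OF A A3]
      mat_trace_mult[OF A A] D_def sum_distrib_left sum.distrib[symmetric] sum_subtractf[symmetric]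
    by (intro sum.cong refl) (simp add: algebra_simps power2_eq_square)
  also have "mat_trace (A * A ^\<^sub>m 3) = mat_trace (A ^\<^sub>m 3 * A)"
    by (rule mat_trace_mult_commute[OF A A3])
  also have "mat_trace (A ^\<^sub>m 3 * A ^\<^sub>m 3) - of_real c * mat_trace (A ^\<^sub>m 3 * A)
      - of_real c * mat_trace (A ^\<^sub>m 3 * A) + of_real (c\<^sup>2) * mat_trace (A * A) =
      complex_of_real (\<Sum>r\<leftarrow>rs. (r ^ 3 - c * r)\<^sup>2)"
    unfolding 2 4 6 tr
    by (induction rs) (simp_all add: algebra_simps power2_eq_square eval_nat_numeral)
  finally have eq: "(\<Sum>i<n. \<Sum>j<n. (cmod (D i j))\<^sup>2) = (\<Sum>r\<leftarrow>rs. (r ^ 3 - c * r)\<^sup>2)"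
    by (simp only: of_real_eq_iff)
  have "(\<forall>r\<in>set rs. r ^ 3 = c * r) \<longleftrightarrow> (\<Sum>r\<leftarrow>rs. (r ^ 3 - c * r)\<^sup>2) = 0"
    by (subst sum_list_eq_0_iff_nonneg) auto
  also have "\<dots> \<longleftrightarrow> (\<forall>i<n. \<forall>j<n. D i j = 0)"
    unfolding eq[symmetric] by (auto simp: sum_nonneg_eq_0_iff sum_nonneg)
  also have "\<dots> \<longleftrightarrow> (\<forall>i<n. \<forall>j<n. (A ^\<^sub>m 3) $$ (i, j) = of_real c * A $$ (i, j))"
    by (simp add: D_def)
  finally show ?thesis .
qed

text \<open>The list inequalities in matrix form; for a gain graph \<open>t\<close> will be the
  number of arcs. In the last claim all eigenvalues are 0 or of modulus \<open>d\<close>, so that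
  \<open>d * \<bar>r\<bar> = r\<^sup>2\<close>, and summing gives the energy exactly.\<close>

lemma
  assumes h: "hermitian_mat A" and A: "A \<in> carrier_mat n n"
    and t2: "mat_trace (A ^\<^sub>m 2) = of_real t"
  shows matrix_energy_lower_bound:
      "mat_trace (A ^\<^sub>m 3) = 0 \<Longrightarrow> 2 * t \<le> (matrix_energy A)\<^sup>2"
    and matrix_energy_lower_boundD:
      "\<lbrakk>mat_trace (A ^\<^sub>m 3) = 0; 2 * t = (matrix_energy A)\<^sup>2; i < n; j < n\<rbrakk> \<Longrightarrow>
        (A ^\<^sub>m 3) $$ (i, j) = of_real (t / 2) * A $$ (i, j)"
    and matrix_energy_cubic:
      "(\<And>i j. i < n \<Longrightarrow> j < n \<Longrightarrow> (A ^\<^sub>m 3) $$ (i, j) = of_real (d\<^sup>2) * A $$ (i, j)) \<Longrightarrow>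
        0 \<le> d \<Longrightarrow> d * matrix_energy A = t"
proof -
  obtain rs where energy: "matrix_energy A = (\<Sum>r\<leftarrow>rs. \<bar>r\<bar>)"
    and tr: "\<And>k. mat_trace (A ^\<^sub>m k) = of_real (\<Sum>r\<leftarrow>rs. r ^ k)"
    using hermitian_mat_real_spectrum[OF h A] by blast
  have t: "t = (\<Sum>r\<leftarrow>rs. r\<^sup>2)" using t2 unfolding tr of_real_eq_iff by simp
  note cubic = hermitian_mat_cubic[OF h A tr]
  {
    assume "mat_trace (A ^\<^sub>m 3) = 0"
    then have cubes: "(\<Sum>r\<leftarrow>rs. r ^ 3) = 0" unfolding tr of_real_eq_0_iff .
    show "2 * t \<le> (matrix_energy A)\<^sup>2"
      unfolding t energy by (rule sum_list_squares_le_abs[OF cubes])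
    assume "2 * t = (matrix_energy A)\<^sup>2" "i < n" "j < n"
    then show "(A ^\<^sub>m 3) $$ (i, j) = of_real (t / 2) * A $$ (i, j)"
      using sum_list_squares_eq_absD[OF cubes] cubic[of "t / 2"] unfolding t energy by blast
  next
    assume *: "\<And>i j. i < n \<Longrightarrow> j < n \<Longrightarrow> (A ^\<^sub>m 3) $$ (i, j) = of_real (d\<^sup>2) * A $$ (i, j)"
      and "0 \<le> d"
    have "d * \<bar>r\<bar> = r\<^sup>2" if "r \<in> set rs" for r
    proof -
      have "r ^ 3 = d\<^sup>2 * r" using cubic[of "d\<^sup>2"] * that by blast
      then have "r = 0 \<or> \<bar>r\<bar>\<^sup>2 = d\<^sup>2" by (auto simp: power3_eq_cube power2_eq_square)
      then have "r = 0 \<or> \<bar>r\<bar> = d" using \<open>0 \<le> d\<close> by (metis abs_ge_zero power2_eq_imp_eq)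
      then show ?thesis by (metis abs_0 abs_mult_self_eq mult_zero_right power2_eq_square)
    qed
    then show "d * matrix_energy A = t"
      unfolding t energy sum_list_const_mult[symmetric] by (intro arg_cong[of _ _ sum_list] map_cong) auto
  }
qed

section \<open>Gain graphs\<close>

text \<open>Equality case of the triangle inequality. For unit numbers the squared distance of
  \<open>f i\<close> to \<open>w\<close> is \<open>2 - 2 * Re (f i * cnj w)\<close>, and the
  hypothesis on the sum makes these distances add up to 0.\<close>

lemma sum_unit_complex_eqD:
  fixes f :: "'i \<Rightarrow> complex"
  assumes fin: "finite I" and f: "\<And>i. i \<in> I \<Longrightarrow> cmod (f i) = 1" and w: "cmod w = 1"
    and sum: "(\<Sum>i\<in>I. f i) = of_nat (card I) * w" and i: "i \<in> I"
  shows "f i = w"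
proof -
  have "(\<Sum>i\<in>I. (cmod (f i - w))\<^sup>2) = (\<Sum>i\<in>I. 2 - 2 * Re (f i * cnj w))"
  proof (intro sum.cong refl)
    fix i assume "i \<in> I"
    then have "(Re (f i))\<^sup>2 + (Im (f i))\<^sup>2 = 1" "(Re w)\<^sup>2 + (Im w)\<^sup>2 = 1"
      using f w by (metis cmod_power2 one_power2)+
    then show "(cmod (f i - w))\<^sup>2 = 2 - 2 * Re (f i * cnj w)"
      by (simp add: cmod_power2 power2_diff)
  qed
  also have "\<dots> = 2 * real (card I) - 2 * Re ((\<Sum>i\<in>I. f i) * cnj w)"
    by (simp add: sum_subtractf sum_distrib_right sum_distrib_left sum.distrib algebra_simps)
  also have "(\<Sum>i\<in>I. f i) * cnj w = of_nat (card I)"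
    using w by (simp add: sum mult.assoc complex_norm_square[symmetric])
  finally have "(\<Sum>i\<in>I. (cmod (f i - w))\<^sup>2) = 0" by simp
  then show ?thesis using i fin by (auto simp: sum_nonneg_eq_0_iff)
qed

section \<open>Neighbourhoods and gains of arcs\<close>

context gain_graph
begin

definition nbrs :: "'a \<Rightarrow> 'a set" where
  "nbrs u = {v. (u, v) \<in> parcs G}"

text \<open>Matrix entries indexed by vertices rather than by positions in \<open>vs\<close>, so
  that sums over walks do not mention the enumeration.\<close>

definition adj :: "'a \<Rightarrow> 'a \<Rightarrow> complex" where
  "adj u v = (if (u, v) \<in> parcs G then \<phi> (u, v) else 0)"

lemma arc_sym: "(u, v) \<in> parcs G \<Longrightarrow> (v, u) \<in> parcs G"
  by (rule arcs_symmetric)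

lemma nbrs_subset: "nbrs u \<subseteq> pverts G"
  using in_arcsD2 by (auto simp: nbrs_def)

lemma finite_nbrs: "finite (nbrs u)"
  using nbrs_subset finite_verts by (rule finite_subset)

lemma gain_mult_reverse: "(u, v) \<in> parcs G \<Longrightarrow> \<phi> (u, v) * \<phi> (v, u) = 1"
  using gain_inverse[of u v] gain_unit[OF arc_sym, of u v]
  by (metis left_inverse norm_zero zero_neq_one)

lemma cnj_gain: "(u, v) \<in> parcs G \<Longrightarrow> cnj (\<phi> (u, v)) = \<phi> (v, u)"
  using gain_mult_reverse[of u v] gain_unit[of u v] complex_norm_square[of "\<phi> (u, v)"]
  by (metis mult_cancel_left mult_zero_left of_real_1 one_power2 zero_neq_one)

lemma cnj_adj: "cnj (adj u v) = adj v u"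
  using arc_sym by (auto simp: adj_def cnj_gain)

lemma out_degree_eq_card_nbrs: "out_degree G u = card (nbrs u)"
proof -
  have "out_arcs G u = Pair u ` nbrs u" by (auto simp: out_arcs_def nbrs_def)
  then show ?thesis by (simp add: out_degree_def card_image inj_on_def)
qed

lemma card_arcs: "card (parcs G) = (\<Sum>u\<in>pverts G. card (nbrs u))"
proof -
  have "parcs G = (SIGMA u:pverts G. nbrs u)"
    using in_arcsD1 by (auto simp: nbrs_def)
  then show ?thesis using finite_verts finite_nbrs by simp
qed

lemma min_degree_le: "u \<in> pverts G \<Longrightarrow> min_degree G \<le> card (nbrs u)"
  unfolding min_degree_def using finite_verts by (simp add: out_degree_eq_card_nbrs)

section \<open>Powers of the adjacency matrix as sums over walks\<close>

context
  fixes vs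
  assumes vs: "distinct vs" "set vs = pverts G"
begin

abbreviation (input) "A \<equiv> gain_adjacency_matrix G \<phi> vs"

lemma adjacency_carrier: "A \<in> carrier_mat (length vs) (length vs)"
  by (simp add: gain_adjacency_matrix_def)

lemma adjacency_index: "i < length vs \<Longrightarrow> j < length vs \<Longrightarrow> A $$ (i, j) = adj (vs ! i) (vs ! j)"
  by (simp add: gain_adjacency_matrix_def adj_def)

lemma sum_vertices: "(\<Sum>i<length vs. f (vs ! i)) = (\<Sum>v\<in>pverts G. f v)"
  using sum.reindex_bij_betw[OF bij_betw_nth[OF vs(1) refl refl], of f] vs(2) by simp

lemma adjacency_hermitian: "hermitian_mat A"
  using adjacency_carrier by (auto simp: hermitian_mat_def adjacency_index cnj_adj)

lemma adjacency_square_index: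
  assumes "i < length vs" "j < length vs"
  shows "(A ^\<^sub>m 2) $$ (i, j) = (\<Sum>x\<in>pverts G. adj (vs ! i) x * adj x (vs ! j))"
proof -
  have "A ^\<^sub>m 2 = A * A" using adjacency_carrier by (simp add: numeral_2_eq_2)
  then show ?thesis
    using mult_mat_index[OF adjacency_carrier adjacency_carrier assms] assms
    by (simp add: adjacency_index flip: sum_vertices)
qed

lemma adjacency_cube_index:
  assumes ij: "i < length vs" "j < length vs"
  shows "(A ^\<^sub>m 3) $$ (i, j) =
    (\<Sum>x\<in>pverts G. \<Sum>y\<in>pverts G. adj (vs ! i) x * adj x y * adj y (vs ! j))"
proof -
  have A2: "A ^\<^sub>m 2 \<in> carrier_mat (length vs) (length vs)" using adjacency_carrier by simp
  have "A ^\<^sub>m 3 = A ^\<^sub>m 2 * A"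
    using pow_mat_add[OF adjacency_carrier, of 2 1] adjacency_carrier by simp
  then have "(A ^\<^sub>m 3) $$ (i, j) =
      (\<Sum>y<length vs. (\<Sum>x\<in>pverts G. adj (vs ! i) x * adj x (vs ! y)) * adj (vs ! y) (vs ! j))"
    using mult_mat_index[OF A2 adjacency_carrier ij] ij
    by (simp add: adjacency_index adjacency_square_index)
  also have "\<dots> = (\<Sum>y\<in>pverts G. (\<Sum>x\<in>pverts G. adj (vs ! i) x * adj x y) * adj y (vs ! j))"
    by (rule sum_vertices)
  finally show ?thesis
    unfolding sum_distrib_right by (subst sum.swap)
qed

text \<open>A closed walk \<open>u, v, u\<close> has gain 1 because its two arcs carry inverse
  gains; hence every arc contributes exactly 1.\<close>

lemma mat_trace_adjacency_square: "mat_trace (A ^\<^sub>m 2) = of_nat (card (parcs G))"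
proof -
  have "mat_trace (A ^\<^sub>m 2) =
      (\<Sum>i<length vs. \<Sum>v\<in>pverts G. adj (vs ! i) v * adj v (vs ! i))"
    using adjacency_carrier by (simp add: mat_trace_def adjacency_square_index)
  also have "\<dots> = (\<Sum>u\<in>pverts G. \<Sum>v\<in>pverts G. adj u v * adj v u)"
    by (rule sum_vertices)
  also have "\<dots> = (\<Sum>u\<in>pverts G. \<Sum>v\<in>pverts G. if v \<in> nbrs u then 1 else 0)"
    by (intro sum.cong refl) (auto simp: adj_def nbrs_def gain_mult_reverse dest: arc_sym)
  also have "\<dots> = (\<Sum>u\<in>pverts G. of_nat (card (nbrs u)))"
    using finite_verts nbrs_subset by (simp add: sum.If_cases Int_absorb1)
  finally show ?thesis by (simp add: card_arcs)
qed

lemma mat_trace_adjacency_cube: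
  assumes "triangle_free G"
  shows "mat_trace (A ^\<^sub>m 3) = 0"
proof -
  have zero: "adj u x * adj x y * adj y u = 0" for u x y
  proof -
    have "(u, x) \<notin> parcs G \<or> (x, y) \<notin> parcs G \<or> (y, u) \<notin> parcs G"
      using assms unfolding triangle_free_def by blast
    then show ?thesis unfolding adj_def by (elim disjE) simp_all
  qed
  have "(A ^\<^sub>m 3) $$ (i, i) = 0" if "i < length vs" for i
  proof -
    have "(A ^\<^sub>m 3) $$ (i, i) =
        (\<Sum>x\<in>pverts G. \<Sum>y\<in>pverts G. adj (vs ! i) x * adj x y * adj y (vs ! i))"
      by (rule adjacency_cube_index[OF that that])
    also have "\<dots> = 0" by (intro sum.neutral ballI) (rule zero)
    finally show ?thesis .
  qed
  then show ?thesis
    using adjacency_carrier by (simp add: mat_trace_def)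
qed

lemma gain_energy_square_ge:
  assumes "triangle_free G"
  shows "2 * real (card (parcs G)) \<le> (gain_energy G \<phi> vs)\<^sup>2"
  unfolding gain_energy_def
  using matrix_energy_lower_bound[OF adjacency_hermitian adjacency_carrier _
      mat_trace_adjacency_cube[OF assms]] mat_trace_adjacency_square by simp

end

section \<open>Counting arcs in triangle-free graphs\<close>

lemma triangle_free_nbrs_disjoint:
  "triangle_free G \<Longrightarrow> (u, v) \<in> parcs G \<Longrightarrow> nbrs u \<inter> nbrs v = {}"
  unfolding triangle_free_def nbrs_def using arc_sym by blast

lemma triangle_free_min_degree_le:
  assumes tf: "triangle_free G" and ne: "pverts G \<noteq> {}" and pos: "min_degree G > 0"
  shows "2 * min_degree G \<le> card (pverts G)"
proof -
  obtain u where u: "u \<in> pverts G" using ne by blast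
  then have "nbrs u \<noteq> {}" using min_degree_le[OF u] pos by auto
  then obtain v where v: "(u, v) \<in> parcs G" by (auto simp: nbrs_def)
  have "card (nbrs u) + card (nbrs v) = card (nbrs u \<union> nbrs v)"
    using finite_nbrs triangle_free_nbrs_disjoint[OF tf v] by (simp add: card_Un_disjoint)
  also have "\<dots> \<le> card (pverts G)"
    using nbrs_subset finite_verts by (intro card_mono) auto
  finally show ?thesis using min_degree_le[OF u] min_degree_le[OF in_arcsD2[OF v]] by simp
qed

text \<open>Every edge yields two arcs, so \<open>card (parcs G)\<close> is the full degree
  sum.\<close>

lemma card_arcs_ge:
  assumes tf: "triangle_free G" and ne: "pverts G \<noteq> {}"
  shows "min_degree G * card (pverts G) \<le> card (parcs G)"
    and "2 * (min_degree G)\<^sup>2 \<le> card (parcs G)"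
proof -
  show *: "min_degree G * card (pverts G) \<le> card (parcs G)"
    unfolding card_arcs using sum_bounded_below[OF min_degree_le, of "pverts G" "\<lambda>u. u"]
    by (simp add: mult.commute)
  show "2 * (min_degree G)\<^sup>2 \<le> card (parcs G)"
  proof (cases "min_degree G > 0")
    case True
    have "min_degree G * (2 * min_degree G) \<le> min_degree G * card (pverts G)"
      using triangle_free_min_degree_le[OF tf ne True] by simp
    also note *
    finally show ?thesis by (simp add: power2_eq_square mult_ac)
  qed simp
qed

text \<open>Both counting inequalities are tight: there are \<open>2 * d\<close> vertices, all of
  degree \<open>d\<close>. The disjoint neighbourhoods of the ends of an edge therefore exhaust the
  vertices and serve as the two parts.\<close>

lemma extremal_imp_complete_bipartite:
  assumes tf: "triangle_free G" and ne: "pverts G \<noteq> {}" and pos: "min_degree G > 0"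
    and arcs: "card (parcs G) = 2 * (min_degree G)\<^sup>2"
  shows "complete_bipartite_digraph (min_degree G) (min_degree G) (with_proj G)"
proof -
  define d where "d = min_degree G"
  have "d * card (pverts G) \<le> d * (2 * d)"
    using card_arcs_ge(1)[OF tf ne] arcs by (simp add: d_def power2_eq_square)
  then have n: "card (pverts G) = 2 * d"
    using pos triangle_free_min_degree_le[OF tf ne pos] by (simp add: d_def)
  have "(\<Sum>u\<in>pverts G. card (nbrs u)) = (\<Sum>u\<in>pverts G. d)"
    using arcs n by (simp add: card_arcs[symmetric] d_def power2_eq_square)
  then have "\<forall>u\<in>pverts G. card (nbrs u) = d"
    using sum_mono_inv[of "\<lambda>_. d" "pverts G" "\<lambda>u. card (nbrs u)"] min_degree_le finite_verts
    by (metis d_def)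
  then have deg: "card (nbrs u) = d" if "u \<in> pverts G" for u using that by blast
  obtain u where u: "u \<in> pverts G" using ne by blast
  then have "nbrs u \<noteq> {}" using deg[OF u] pos by (auto simp: d_def)
  then obtain v where uv: "(u, v) \<in> parcs G" by (auto simp: nbrs_def)
  have v: "v \<in> pverts G" using uv by (rule in_arcsD2)
  have disj: "nbrs u \<inter> nbrs v = {}" using triangle_free_nbrs_disjoint[OF tf uv] .
  have V: "pverts G = nbrs u \<union> nbrs v"
    using finite_verts nbrs_subset deg[OF u] deg[OF v] disj finite_nbrs n
    by (intro card_subset_eq[symmetric]) (auto simp: card_Un_disjoint)
  \<comment> \<open>A neighbour \<open>x\<close> of \<open>a\<close> has no neighbour in
    \<open>nbrs a\<close>, so \<open>nbrs x\<close> lies in \<open>nbrs b\<close>; both have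
    \<open>d\<close> elements. This is applied to \<open>u, v\<close> in both orders.\<close>
  have bip: "nbrs x = nbrs b" if "(a, x) \<in> parcs G" "x \<in> pverts G" "b \<in> pverts G"
    "nbrs a \<inter> nbrs b = {}" "pverts G = nbrs a \<union> nbrs b" for a b x
  proof -
    have "nbrs x \<subseteq> nbrs b"
      using triangle_free_nbrs_disjoint[OF tf that(1)] nbrs_subset[of x] that(5) by blast
    then show ?thesis using deg that(2,3) finite_nbrs by (intro card_subset_eq) auto
  qed
  have "nbrs x = nbrs v" if "x \<in> nbrs u" for x
    using that bip[of u x v] disj V v nbrs_subset by (auto simp: nbrs_def)
  moreover have "nbrs x = nbrs u" if "x \<in> nbrs v" for x
    using that bip[of v x u] disj V u nbrs_subset by (auto simp: nbrs_def)
  ultimately have "parcs G = nbrs u \<times> nbrs v \<union> nbrs v \<times> nbrs u"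
    using V in_arcsD1 unfolding nbrs_def by fast
  then show ?thesis
    unfolding complete_bipartite_digraph_pair_def d_def[symmetric]
    using V disj deg[OF u] deg[OF v] finite_verts by blast
qed

section \<open>Balance and walks of length three on complete bipartite graphs\<close>

lemma closed_walk_gain:
  assumes step: "\<And>p x y q. \<lbrakk>(p, x) \<in> parcs G; (x, y) \<in> parcs G; (y, q) \<in> parcs G\<rbrakk> \<Longrightarrow>
      (p, q) \<in> parcs G \<and> \<phi> (p, x) * \<phi> (x, y) * \<phi> (y, q) = \<phi> (p, q)"
    and "pcas u p u" "set p \<subseteq> parcs G"
  shows "prod_list (map \<phi> p) = 1"
  using assms(2,3)
proof (induction p rule: length_induct)
  case (1 p)
  \<comment> \<open>By \<open>step\<close> the first three arcs can be replaced by one arc of the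
    same gain, which shortens the walk by two. A single closed arc would be a loop, and two arcs
    traverse one edge back and forth.\<close>
  consider "p = []" | e where "p = [e]" | e f where "p = [e, f]" | e f g r where "p = e # f # g # r"
    by (metis neq_Nil_conv)
  then show ?case
  proof cases
    case 2
    then show ?thesis using 1 no_loops' by (cases e) auto
  next
    case 3
    then obtain v where "p = [(u, v), (v, u)]" using 1 by (cases e; cases f) auto
    then show ?thesis using 1 gain_mult_reverse by auto
  next
    case 4
    then obtain x y q where p: "p = (u, x) # (x, y) # (y, q) # r"
      using 1 by (cases e; cases f; cases g) auto
    have *: "(u, q) \<in> parcs G \<and> \<phi> (u, x) * \<phi> (x, y) * \<phi> (y, q) = \<phi> (u, q)"
      using 1 p by (intro step) auto
    then have "prod_list (map \<phi> ((u, q) # r)) = 1"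
      using 1 p by (intro 1(1)[rule_format]) auto
    then show ?thesis using * p by (simp add: mult.assoc[symmetric])
  qed simp
qed

end

locale complete_bipartite_gain_graph = gain_graph +
  fixes U V and d :: nat
  assumes verts_Un: "pverts G = U \<union> V" and parts_disjoint: "U \<inter> V = {}"
    and card_U: "card U = d" and card_V: "card V = d"
    and arcs_eq: "parcs G = U \<times> V \<union> V \<times> U"
begin

text \<open>Three changes of side end in the opposite part, all of whose vertices are adjacent to
  \<open>p\<close>.\<close>

lemma arc3: "\<lbrakk>(p, x) \<in> parcs G; (x, y) \<in> parcs G; (y, q) \<in> parcs G\<rbrakk> \<Longrightarrow> (p, q) \<in> parcs G"
  using arcs_eq parts_disjoint by auto

lemma card_nbrs: "u \<in> pverts G \<Longrightarrow> card (nbrs u) = d"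
proof -
  assume "u \<in> pverts G"
  then have "nbrs u = V \<or> nbrs u = U"
    using arcs_eq parts_disjoint verts_Un by (auto simp: nbrs_def)
  then show ?thesis using card_U card_V by auto
qed

lemma card_arcs_complete_bipartite: "card (parcs G) = 2 * d\<^sup>2"
proof -
  have "card (pverts G) = 2 * d"
    using verts_Un parts_disjoint card_U card_V finite_verts by (simp add: card_Un_disjoint)
  then show ?thesis by (simp add: card_arcs card_nbrs power2_eq_square)
qed

text \<open>Link between balance and the cubic matrix identity: balance of the 4-cycles, stated so
  as to include backtracking walks.\<close>

definition walk3_gain :: bool where
  "walk3_gain \<longleftrightarrow> (\<forall>p x y q. (p, x) \<in> parcs G \<longrightarrow> (x, y) \<in> parcs G \<longrightarrow> (y, q) \<in> parcs G \<longrightarrow>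
     \<phi> (p, x) * \<phi> (x, y) * \<phi> (y, q) = \<phi> (p, q))"

lemma balanced_iff_walk3_gain: "gain_balanced G \<phi> \<longleftrightarrow> walk3_gain"
proof
  assume bal: "gain_balanced G \<phi>"
  show walk3_gain
    unfolding walk3_gain_def
  proof (intro allI impI)
    fix p x y q
    assume a: "(p, x) \<in> parcs G" "(x, y) \<in> parcs G" "(y, q) \<in> parcs G"
    note pq = arc3[OF a]
    show "\<phi> (p, x) * \<phi> (x, y) * \<phi> (y, q) = \<phi> (p, q)"
    \<comment> \<open>In these cases the walk traverses an edge back and forth and the two gains
      cancel. Otherwise the four vertices are distinct, and the arc from \<open>q\<close> to
      \<open>p\<close> closes the walk to a 4-cycle.\<close>
    proof (cases "p = y \<or> x = q")
      case True
      then show ?thesis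
        using gain_mult_reverse[OF a(1)] gain_mult_reverse[OF a(2)] by (auto simp: mult.assoc)
    next
      case False
      have "awalk p [(p, x), (x, y), (y, q), (q, p)] p"
        using a pq arc_sym in_arcsD1[OF a(1)] by (auto simp: awalk_def)
      then have "cycle [(p, x), (x, y), (y, q), (q, p)]"
        unfolding cycle_def using False a pq no_loops' by (intro exI[of _ p]) auto
      then have "\<phi> (p, x) * \<phi> (x, y) * \<phi> (y, q) * \<phi> (q, p) = 1"
        using bal unfolding gain_balanced_def by (fastforce simp: mult.assoc)
      then show ?thesis
        using gain_mult_reverse[OF pq] by (metis mult.assoc mult.commute mult.left_neutral)
    qed
  qed
next
  assume walk3_gain
  then have step: "(p, q) \<in> parcs G \<and> \<phi> (p, x) * \<phi> (x, y) * \<phi> (y, q) = \<phi> (p, q)"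
    if "(p, x) \<in> parcs G" "(x, y) \<in> parcs G" "(y, q) \<in> parcs G" for p x y q
    using that arc3 unfolding walk3_gain_def by blast
  have "prod_list (map \<phi> p) = 1" if "cycle p" for p
  proof -
    obtain u where u: "pcas u p u" "set p \<subseteq> parcs G"
      using \<open>cycle p\<close> unfolding cycle_def awalk_def by blast
    show ?thesis using step u by (rule closed_walk_gain)
  qed
  then show "gain_balanced G \<phi>" unfolding gain_balanced_def by blast
qed

text \<open>For non-adjacent \<open>p, q\<close> both sides vanish, as no walk of length 3 joins
  them. For adjacent ones the identity says that \<open>d\<^sup>2\<close> unit gains have the unit
  mean \<open>\<phi> (p, q)\<close>, which forces them all to be equal to it.\<close>

lemma walk3_gain_iff_cubic:
  assumes vs: "distinct vs" "set vs = pverts G"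
  shows "walk3_gain \<longleftrightarrow> (\<forall>i<length vs. \<forall>j<length vs.
    (gain_adjacency_matrix G \<phi> vs ^\<^sub>m 3) $$ (i, j) =
      of_real ((real d)\<^sup>2) * gain_adjacency_matrix G \<phi> vs $$ (i, j))"
proof -
  define S where "S p q = (\<Sum>x\<in>pverts G. \<Sum>y\<in>pverts G. adj p x * adj x y * adj y q)" for p q
  define g where "g p q = (\<lambda>(x, y). \<phi> (p, x) * \<phi> (x, y) * \<phi> (y, q))" for p q
  have non_arc: "S p q = of_real ((real d)\<^sup>2) * adj p q" if "(p, q) \<notin> parcs G" for p q
  proof -
    have "adj p x * adj x y * adj y q = 0" for x y
      using that arc3 by (auto simp: adj_def)
    then show ?thesis using that by (simp add: S_def adj_def)
  qed
  have arc: "S p q = (\<Sum>z\<in>nbrs p \<times> nbrs q. g p q z)" if pq: "(p, q) \<in> parcs G" for p q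
  proof -
    \<comment> \<open>Here \<open>x\<close> is on the side of \<open>q\<close> and \<open>y\<close>
      on that of \<open>p\<close>, so each choice in \<open>nbrs p \<times> nbrs q\<close> gives a
      walk.\<close>
    have inner: "(x, y) \<in> parcs G" if "x \<in> nbrs p" "y \<in> nbrs q" for x y
      using pq that arcs_eq parts_disjoint by (auto simp: nbrs_def)
    have "S p q = (\<Sum>x\<in>nbrs p. \<Sum>y\<in>pverts G. adj p x * adj x y * adj y q)"
      unfolding S_def using finite_verts nbrs_subset
      by (intro sum.mono_neutral_right) (auto simp: adj_def nbrs_def)
    also have "\<dots> = (\<Sum>x\<in>nbrs p. \<Sum>y\<in>nbrs q. adj p x * adj x y * adj y q)"
      using finite_verts nbrs_subset arc_sym
      by (intro sum.cong refl sum.mono_neutral_right) (auto simp: adj_def nbrs_def)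
    also have "\<dots> = (\<Sum>x\<in>nbrs p. \<Sum>y\<in>nbrs q. g p q (x, y))"
    proof (intro sum.cong refl)
      fix x y assume xy: "x \<in> nbrs p" "y \<in> nbrs q"
      then have "(p, x) \<in> parcs G" "(y, q) \<in> parcs G" using arc_sym by (simp_all add: nbrs_def)
      then show "adj p x * adj x y * adj y q = g p q (x, y)"
        using inner[OF xy] by (simp add: adj_def g_def)
    qed
    finally show ?thesis by (simp add: sum.cartesian_product)
  qed
  have card: "card (nbrs p \<times> nbrs q) = d\<^sup>2" if "(p, q) \<in> parcs G" for p q
    using that card_nbrs in_arcsD1 in_arcsD2 by (simp add: power2_eq_square card_cartesian_product)
  have pointwise: "S p q = of_real ((real d)\<^sup>2) * adj p q \<longleftrightarrow>
      (\<forall>z\<in>nbrs p \<times> nbrs q. g p q z = \<phi> (p, q))" if pq: "(p, q) \<in> parcs G" for p q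
  proof
    assume "S p q = of_real ((real d)\<^sup>2) * adj p q"
    then have sum: "(\<Sum>z\<in>nbrs p \<times> nbrs q. g p q z) = of_nat (card (nbrs p \<times> nbrs q)) * \<phi> (p, q)"
      using pq arc[OF pq] card[OF pq] by (simp add: adj_def del: card_cartesian_product)
    have "cmod (g p q z) = 1" if "z \<in> nbrs p \<times> nbrs q" for z
      using that pq arcs_eq parts_disjoint arc_sym gain_unit
      by (auto simp: g_def nbrs_def norm_mult)
    then show "\<forall>z\<in>nbrs p \<times> nbrs q. g p q z = \<phi> (p, q)"
      using sum_unit_complex_eqD[OF _ _ gain_unit[OF pq] sum] finite_nbrs by blast
  next
    assume "\<forall>z\<in>nbrs p \<times> nbrs q. g p q z = \<phi> (p, q)"
    then have "(\<Sum>z\<in>nbrs p \<times> nbrs q. g p q z) = (\<Sum>z\<in>nbrs p \<times> nbrs q. \<phi> (p, q))"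
      by (intro sum.cong) auto
    then show "S p q = of_real ((real d)\<^sup>2) * adj p q"
      using pq arc[OF pq] card[OF pq] by (simp add: adj_def del: card_cartesian_product)
  qed
  have "walk3_gain \<longleftrightarrow> (\<forall>p q. (p, q) \<in> parcs G \<longrightarrow> (\<forall>z\<in>nbrs p \<times> nbrs q. g p q z = \<phi> (p, q)))"
    (is "_ = ?R")
  proof
    assume w: walk3_gain
    show ?R
    proof (intro allI impI ballI)
      fix p q z assume pq: "(p, q) \<in> parcs G" and "z \<in> nbrs p \<times> nbrs q"
      then obtain x y where z: "z = (x, y)" "(p, x) \<in> parcs G" "(y, q) \<in> parcs G"
        by (auto simp: nbrs_def intro: arc_sym)
      have "(x, y) \<in> parcs G" using z pq arcs_eq parts_disjoint by auto
      then show "g p q z = \<phi> (p, q)" using w z unfolding walk3_gain_def g_def by simp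
    qed
  next
    assume r: ?R
    show walk3_gain
      unfolding walk3_gain_def
    proof (intro allI impI)
      fix p x y q assume a: "(p, x) \<in> parcs G" "(x, y) \<in> parcs G" "(y, q) \<in> parcs G"
      then have "(x, y) \<in> nbrs p \<times> nbrs q" by (auto simp: nbrs_def intro: arc_sym)
      then show "\<phi> (p, x) * \<phi> (x, y) * \<phi> (y, q) = \<phi> (p, q)"
        using r arc3[OF a] unfolding g_def by fastforce
    qed
  qed
  \<comment> \<open>The pairs added to the arcs satisfy the equation by
    \<open>non_arc\<close>.\<close>
  also have "\<dots> \<longleftrightarrow> (\<forall>p\<in>set vs. \<forall>q\<in>set vs. S p q = of_real ((real d)\<^sup>2) * adj p q)"
    using non_arc pointwise in_arcsD1 in_arcsD2 vs(2) by metis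
  also have "\<dots> \<longleftrightarrow> (\<forall>i<length vs. \<forall>j<length vs.
      S (vs ! i) (vs ! j) = of_real ((real d)\<^sup>2) * adj (vs ! i) (vs ! j))"
    by (simp add: all_set_conv_all_nth)
  finally show ?thesis
    by (simp add: adjacency_cube_index[OF vs] adjacency_index[OF vs] S_def)
qed

end

theorem theorem3p3:
  fixes G :: "'a pair_pre_digraph"
    and \<phi> :: "'a \<times> 'a \<Rightarrow> complex"
    and vs :: "'a list"
    and \<delta> :: nat
  assumes "gain_graph G \<phi>"
    and "distinct vs" and "set vs = pverts G"
    and "Digraph_Component.connected (with_proj G)"
    and "triangle_free G"
    and "\<delta> = min_degree G"
  shows "gain_energy G \<phi> vs \<ge> 2 * real \<delta> \<and>
    (\<delta> \<ge> 1 \<longrightarrow>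
      (gain_energy G \<phi> vs = 2 * real \<delta> \<longleftrightarrow>
        gain_balanced G \<phi> \<and> complete_bipartite_digraph \<delta> \<delta> (with_proj G)))"
proof -
  interpret gain_graph G \<phi> by fact
  note vs = assms(2,3) and tf = assms(5)
  let ?E = "gain_energy G \<phi> vs" and ?M = "real (card (parcs G))"
  let ?A = "gain_adjacency_matrix G \<phi> vs"
  note hermitian = adjacency_hermitian[OF vs] and carrier = adjacency_carrier[OF vs]
  have t2: "mat_trace (?A ^\<^sub>m 2) = of_real ?M"
    using mat_trace_adjacency_square[OF vs] by simp
  \<comment> \<open>Connectedness supplies a vertex, so \<open>min_degree G\<close> is the minimum
    of a nonempty set.\<close>
  have ne: "pverts G \<noteq> {}"
    using assms(4) by (auto simp: connected_def strongly_connected_def)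
  have "2 * (min_degree G)\<^sup>2 \<le> card (parcs G)" by (rule card_arcs_ge(2)[OF tf ne])
  then have M: "2 * (real \<delta>)\<^sup>2 \<le> ?M"
    unfolding assms(6)[symmetric] by (metis of_nat_le_iff of_nat_mult of_nat_numeral of_nat_power)
  have E: "2 * ?M \<le> ?E\<^sup>2" by (rule gain_energy_square_ge[OF vs tf])
  have "0 \<le> ?E"
    unfolding gain_energy_def matrix_energy_def by (intro sum_nonneg) simp
  moreover have "(2 * real \<delta>)\<^sup>2 \<le> ?E\<^sup>2" using M E by (simp add: power_mult_distrib)
  ultimately have bound: "2 * real \<delta> \<le> ?E" by (metis power2_le_imp_le)
  \<comment> \<open>For \<open>\<delta> = 0\<close> a connected graph is a single vertex of energy
    0, which is not the empty graph with both parts of size 0; hence the restriction to positive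
    \<open>\<delta>\<close>.\<close>
  have "?E = 2 * real \<delta> \<longleftrightarrow> gain_balanced G \<phi> \<and> complete_bipartite_digraph \<delta> \<delta> (with_proj G)"
    if pos: "\<delta> \<ge> 1"
  proof
    assume eq: "?E = 2 * real \<delta>"
    \<comment> \<open>The chain \<open>4 * \<delta>\<^sup>2 \<le> 2 * ?M \<le> ?E\<^sup>2\<close>
      collapses.\<close>
    then have M': "?M = 2 * (real \<delta>)\<^sup>2" using M E by (simp add: power_mult_distrib)
    then have "real (card (parcs G)) = real (2 * \<delta>\<^sup>2)" by simp
    then have "card (parcs G) = 2 * \<delta>\<^sup>2" by (simp only: of_nat_eq_iff)
    then have K: "complete_bipartite_digraph \<delta> \<delta> (with_proj G)"
      using extremal_imp_complete_bipartite[OF tf ne] pos assms(6) by simp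
    then obtain U V where "pverts G = U \<union> V" "U \<inter> V = {}" "card U = \<delta>" "card V = \<delta>"
        "parcs G = U \<times> V \<union> V \<times> U"
      unfolding complete_bipartite_digraph_pair_def by blast
    then interpret complete_bipartite_gain_graph G \<phi> U V \<delta> by unfold_locales
    \<comment> \<open>The equality case gives the cubic identity with factor \<open>?M / 2\<close>,
      which is \<open>\<delta>\<^sup>2\<close> by \<open>M'\<close>.\<close>
    have "2 * ?M = (matrix_energy ?A)\<^sup>2"
      using eq M' by (simp add: gain_energy_def power_mult_distrib)
    from matrix_energy_lower_boundD[OF hermitian carrier t2 mat_trace_adjacency_cube[OF vs tf] this]
    have walk3_gain
      unfolding walk3_gain_iff_cubic[OF vs] M' by simp
    then show "gain_balanced G \<phi> \<and> complete_bipartite_digraph \<delta> \<delta> (with_proj G)"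
      using K balanced_iff_walk3_gain by simp
  next
    assume K: "gain_balanced G \<phi> \<and> complete_bipartite_digraph \<delta> \<delta> (with_proj G)"
    then obtain U V where "pverts G = U \<union> V" "U \<inter> V = {}" "card U = \<delta>" "card V = \<delta>"
        "parcs G = U \<times> V \<union> V \<times> U"
      unfolding complete_bipartite_digraph_pair_def by blast
    then interpret complete_bipartite_gain_graph G \<phi> U V \<delta> by unfold_locales
    have walk3_gain using K balanced_iff_walk3_gain by simp
    \<comment> \<open>The cubic identity fixes the moduli of the nonzero eigenvalues as
      \<open>\<delta>\<close>; with \<open>2 * \<delta>\<^sup>2\<close> arcs, cancelling
      \<open>\<delta>\<close> yields the energy.\<close>
    then have "real \<delta> * ?E = ?M"
      unfolding gain_energy_def walk3_gain_iff_cubic[OF vs]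
      by (intro matrix_energy_cubic[OF hermitian carrier t2]) auto
    also have "?M = real \<delta> * (2 * real \<delta>)"
      by (simp add: card_arcs_complete_bipartite power2_eq_square)
    finally show "?E = 2 * real \<delta>" using pos by simp
  qed
  with bound show ?thesis by blast
qed

end
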